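(* For all $q,m\in\mathbb N$, the function $M_{\beta_{q,m}}$ is linear and increasing on $[0,1-\langle\beta_{q,m}\rangle)$.
   Context: $\mathbb N$ denotes the positive integers. For a real number $r$, $\lfloor r\rfloor$ is its integer part and $\langle r\rangle=r-\lfloor r\rfloor$ its fractional part; $\lambda$ is Lebesgue measure. For $q,m\in\mathbb N$, $\beta_{q,m}\in(q,q+1)$ is the real root of $x^m=q x^{m-1}+q x^{m-2}+\cdots+q$; when $m=1$, $\beta_{q,1}=q$. For $\beta>1$ and $\alpha\in[0,1)$, let $T_{\beta,\alpha}:[0,1]\to[0,1]$, $T_{\beta,\alpha}(x)=\beta x+\alpha-\lfloor\beta x+\alpha\rfloor$, with iterates $T_{\beta,\alpha}^n$ ($T_{\beta,\alpha}^0$ is the identity). For $x\in[0,1]$ define $$\tilde g_{\beta,\alpha}(x)=\sum_{n\ge 0:\ x<T_{\beta,\alpha}^n(1)}\frac{1}{\beta^n}-\sum_{n\ge 0:\ x<T_{\beta,\alpha}^n(0)}\frac{1}{\beta^n},\qquad g_{\beta,\alpha}(x)=\frac{\tilde g_{\beta,\alpha}(x)}{\int_{[0,1]}\tilde g_{\beta,\alpha}\,d\lambda};$$ $g_{\beta,\alpha}$ is the density of a $T_{\beta,\alpha}$-invariant probability measure on $[0,1]$. Define $M_\beta(\alpha)=\int_{[0,1]}x\,g_{\beta,\alpha}(x)\,d\lambda(x)$. "Linear" on an interval means of the form $\alpha\mapsto k\alpha+b$ with real constants $k,b$. *)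

theory Defs
  imports "HOL-Analysis.Analysis"
begin

text \<open>
  For \<open>m = 1\<close> the equation reads \<open>x = q\<close>, whose root is the left endpoint of the open interval
  \<open>(q, q + 1)\<close>; for \<open>m \<ge> 2\<close> there is exactly one root in the open interval.
\<close>
definition beta_root :: "nat \<Rightarrow> nat \<Rightarrow> real" where
  "beta_root q m =
     (if m = 1 then real q
      else (THE x. real q < x \<and> x < real q + 1 \<and> x ^ m = (\<Sum>i<m. real q * x ^ i)))"

definition T :: "real \<Rightarrow> real \<Rightarrow> real \<Rightarrow> real" where
  "T \<beta> \<alpha> x = frac (\<beta> * x + \<alpha>)"

text \<open>
  Both sums converge absolutely for every \<open>x\<close> when \<open>\<beta> > 1\<close>, the only range in which the
  following definitions are meaningful.
\<close>
definition g_tilde :: "real \<Rightarrow> real \<Rightarrow> real \<Rightarrow> real" where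
  "g_tilde \<beta> \<alpha> x =
     (\<Sum>\<^sub>\<infinity>n\<in>{n. x < (T \<beta> \<alpha> ^^ n) 1}. 1 / \<beta> ^ n)
   - (\<Sum>\<^sub>\<infinity>n\<in>{n. x < (T \<beta> \<alpha> ^^ n) 0}. 1 / \<beta> ^ n)"

definition g :: "real \<Rightarrow> real \<Rightarrow> real \<Rightarrow> real" where
  "g \<beta> \<alpha> x = g_tilde \<beta> \<alpha> x / (LINT y:{0..1}|lborel. g_tilde \<beta> \<alpha> y)"

definition M :: "real \<Rightarrow> real \<Rightarrow> real" where
  "M \<beta> \<alpha> = (LINT x:{0..1}|lborel. x * g \<beta> \<alpha> x)"

end

theory Submission imports Defs begin

text \<open>
  Write \<open>s n = (\<Sum>i<n. \<beta> ^ i)\<close> and \<open>\<delta> = 1 - frac \<beta>\<close>. The equation of \<open>\<beta> = beta_root q m\<close> implies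
  \<open>\<delta> * s m = 1\<close> (\<open>beta_root_meet\<close>), and this relation carries the rest. Let \<open>0 \<le> \<alpha> < \<delta>\<close>. For \<open>n \<le> m\<close>
  the orbits of the end points are affine in \<open>\<alpha>\<close> with the same slope: \<open>0\<close> is sent to \<open>\<alpha> * s n\<close> and
  \<open>1\<close> to \<open>1 - (\<delta> - \<alpha>) * s n\<close>, because up to time \<open>m\<close> the digits are constant, \<open>0\<close> along the first
  orbit and \<open>\<lfloor>\<beta>\<rfloor>\<close> along the second (\<open>orbit_0\<close>, \<open>orbit_1\<close>). At time \<open>m\<close> both are at
  \<open>\<alpha> / \<delta>\<close>, and they stay together for ever (\<open>orbits_meet\<close>).

  Hence the infinite sums in the density cancel from index \<open>m\<close> on, and what is left is the step
  function \<open>\<Sum>n<m. indicator I\<^sub>n / \<beta> ^ n\<close>, where \<open>I\<^sub>n\<close> is the interval between the two orbit points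
  (\<open>g_tilde_eq_step\<close>). When \<open>\<alpha>\<close> varies, \<open>I\<^sub>n\<close> is translated rigidly: its length \<open>1 - \<delta> * s n\<close> is
  constant and its midpoint moves at speed \<open>s n \<ge> 0\<close>. Therefore the total mass is constant, the
  first moment is affine in \<open>\<alpha>\<close> with nonnegative slope, and \<open>M \<beta>\<close>, their quotient, is affine and
  nondecreasing (\<open>M_eq_affine\<close>). If \<open>m \<ge> 2\<close>, the interval of index \<open>1\<close> occurs in the sum; it has
  positive length and speed \<open>1\<close>, so the slope is positive.
\<close>

section \<open>The two critical orbits\<close>

text \<open>
  The product \<open>\<delta> * s n\<close> is one minus the distance between the two orbits at time \<open>n\<close>. It increases
  with \<open>n\<close> and reaches \<open>1\<close> at time \<open>m\<close>, so the orbits keep their order and their affine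
  formulas stay inside the unit interval until then.
\<close>

lemma geometric_sum_le_bound:
  fixes \<beta> :: real
  assumes "\<beta> > 1" and "(1 - frac \<beta>) * (\<Sum>i<m. \<beta> ^ i) = 1" and "n \<le> m"
  shows "(1 - frac \<beta>) * (\<Sum>i<n. \<beta> ^ i) \<le> 1"
proof -
  have "(\<Sum>i<n. \<beta> ^ i) \<le> (\<Sum>i<m. \<beta> ^ i)"
    using assms by (intro sum_mono2) auto
  then show ?thesis
    using assms(2) frac_lt_1[of \<beta>] mult_left_mono[of _ _ "1 - frac \<beta>"] by fastforce
qed

lemma geometric_sum_less_bound:
  fixes \<beta> :: real
  assumes "\<beta> > 1" and "(1 - frac \<beta>) * (\<Sum>i<m. \<beta> ^ i) = 1" and "n < m"
  shows "(1 - frac \<beta>) * (\<Sum>i<n. \<beta> ^ i) < 1"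
proof -
  have "(\<Sum>i<n. \<beta> ^ i) < (\<Sum>i<Suc n. \<beta> ^ i)"
    using assms(1) by simp
  then have "(1 - frac \<beta>) * (\<Sum>i<n. \<beta> ^ i) < (1 - frac \<beta>) * (\<Sum>i<Suc n. \<beta> ^ i)"
    using frac_lt_1[of \<beta>] by (intro mult_strict_left_mono) auto
  also have "\<dots> \<le> 1"
    using assms by (intro geometric_sum_le_bound[where m = m]) auto
  finally show ?thesis .
qed

lemma geometric_sum_Suc_shift:
  fixes \<beta> :: real
  shows "(\<Sum>i<Suc n. \<beta> ^ i) = \<beta> * (\<Sum>i<n. \<beta> ^ i) + 1"
  by (subst sum.lessThan_Suc_shift) (simp add: sum_distrib_left)

lemma T_iterate_Suc: "(T \<beta> \<alpha> ^^ Suc n) x = frac (\<beta> * (T \<beta> \<alpha> ^^ n) x + \<alpha>)"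
  by (simp add: T_def)

lemma orbit_0:
  assumes \<beta>: "\<beta> > 1" and meet: "(1 - frac \<beta>) * (\<Sum>i<m. \<beta> ^ i) = 1"
    and \<alpha>: "0 \<le> \<alpha>" "\<alpha> < 1 - frac \<beta>" and "n \<le> m"
  shows "(T \<beta> \<alpha> ^^ n) 0 = \<alpha> * (\<Sum>i<n. \<beta> ^ i)"
  using \<open>n \<le> m\<close>
proof (induction n)
  case 0
  then show ?case by simp
next
  case (Suc n)
  let ?s = "\<Sum>i<Suc n. \<beta> ^ i"
  have pos: "?s > 0"
    using \<beta> by (intro sum_pos) auto
  have "\<alpha> * ?s < (1 - frac \<beta>) * ?s"
    using \<alpha> pos by (intro mult_strict_right_mono) auto
  also have "\<dots> \<le> 1"
    using geometric_sum_le_bound[OF \<beta> meet Suc.prems] .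
  finally have "\<alpha> * ?s < 1" .
  moreover have "0 \<le> \<alpha> * ?s"
    using \<alpha> pos by simp
  ultimately have "frac (\<alpha> * ?s) = \<alpha> * ?s"
    by (simp only: frac_eq)
  moreover have "\<beta> * (T \<beta> \<alpha> ^^ n) 0 + \<alpha> = \<alpha> * ?s"
    using Suc by (simp add: geometric_sum_Suc_shift algebra_simps del: sum.lessThan_Suc)
  ultimately show ?case
    by (simp only: T_iterate_Suc)
qed

lemma orbit_1:
  assumes \<beta>: "\<beta> > 1" and meet: "(1 - frac \<beta>) * (\<Sum>i<m. \<beta> ^ i) = 1"
    and \<alpha>: "0 \<le> \<alpha>" "\<alpha> < 1 - frac \<beta>" and "n \<le> m"
  shows "(T \<beta> \<alpha> ^^ n) 1 = 1 - (1 - frac \<beta> - \<alpha>) * (\<Sum>i<n. \<beta> ^ i)"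
  using \<open>n \<le> m\<close>
proof (induction n)
  case 0
  then show ?case by simp
next
  case (Suc n)
  let ?s = "\<Sum>i<Suc n. \<beta> ^ i"
  let ?y = "1 - (1 - frac \<beta> - \<alpha>) * ?s"
  have pos: "?s > 0"
    using \<beta> by (intro sum_pos) auto
  have "(1 - frac \<beta> - \<alpha>) * ?s \<le> (1 - frac \<beta>) * ?s"
    using \<alpha> pos by (intro mult_right_mono) auto
  also have "\<dots> \<le> 1"
    using geometric_sum_le_bound[OF \<beta> meet Suc.prems] .
  finally have "0 \<le> ?y" by simp
  moreover have "?y < 1"
    using \<alpha> pos by simp
  ultimately have "frac ?y = ?y"
    by (simp only: frac_eq)
  \<comment> \<open>The digit produced at each of these steps is the largest one, \<open>\<lfloor>\<beta>\<rfloor>\<close>.\<close>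
  moreover have "\<beta> * (T \<beta> \<alpha> ^^ n) 1 + \<alpha> = ?y + of_int \<lfloor>\<beta>\<rfloor>"
    using Suc.prems unfolding Suc.IH[OF Suc_leD[OF Suc.prems]] geometric_sum_Suc_shift
    by (simp add: frac_def algebra_simps)
  ultimately show ?case
    by (simp only: T_iterate_Suc frac_add_of_int_right)
qed

lemma orbits_meet:
  assumes \<beta>: "\<beta> > 1" and meet: "(1 - frac \<beta>) * (\<Sum>i<m. \<beta> ^ i) = 1"
    and \<alpha>: "0 \<le> \<alpha>" "\<alpha> < 1 - frac \<beta>" and "m \<le> n"
  shows "(T \<beta> \<alpha> ^^ n) 1 = (T \<beta> \<alpha> ^^ n) 0"
  using \<open>m \<le> n\<close>
proof (induction n rule: dec_induct)
  case base
  show ?case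
    using orbit_0[OF \<beta> meet \<alpha> order_refl] orbit_1[OF \<beta> meet \<alpha> order_refl] meet
    by (simp only: left_diff_distrib)
next
  case (step n)
  then show ?case by simp
qed

section \<open>The density as a finite step function\<close>

text \<open>
  Orbits that coincide from time \<open>m\<close> on contribute the same tail to both sums, and the tails are
  finite because they are dominated by a convergent geometric series.
\<close>

lemma g_tilde_eq_finite_sum:
  assumes \<beta>: "\<beta> > 1" and eq: "\<And>n. m \<le> n \<Longrightarrow> (T \<beta> \<alpha> ^^ n) 1 = (T \<beta> \<alpha> ^^ n) 0"
  shows "g_tilde \<beta> \<alpha> x =
    (\<Sum>n<m. (of_bool (x < (T \<beta> \<alpha> ^^ n) 1) - of_bool (x < (T \<beta> \<alpha> ^^ n) 0)) / \<beta> ^ n)"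
proof -
  have "summable (\<lambda>n. norm (1 / \<beta> ^ n))"
    using summable_geometric[of "1 / \<beta>"] \<beta> by (simp add: power_one_over)
  then have "(\<lambda>n. 1 / \<beta> ^ n) summable_on UNIV"
    by (rule norm_summable_imp_summable_on)
  then have summ: "(\<lambda>n. 1 / \<beta> ^ n) summable_on A" for A
    by (rule summable_on_subset) auto
  have split: "(\<Sum>\<^sub>\<infinity>n\<in>{n. P n}. 1 / \<beta> ^ n) =
      (\<Sum>n<m. of_bool (P n) / \<beta> ^ n) + (\<Sum>\<^sub>\<infinity>n\<in>{n. m \<le> n \<and> P n}. 1 / \<beta> ^ n)" for P
  proof -
    have "{n. P n} = {n. n < m \<and> P n} \<union> {n. m \<le> n \<and> P n}"
      by auto
    moreover have "(\<Sum>\<^sub>\<infinity>n\<in>\<dots>. 1 / \<beta> ^ n) =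
        (\<Sum>\<^sub>\<infinity>n\<in>{n. n < m \<and> P n}. 1 / \<beta> ^ n) + (\<Sum>\<^sub>\<infinity>n\<in>{n. m \<le> n \<and> P n}. 1 / \<beta> ^ n)"
      by (intro infsum_Un_disjoint summ) auto
    moreover have "(\<Sum>\<^sub>\<infinity>n\<in>{n. n < m \<and> P n}. 1 / \<beta> ^ n) = (\<Sum>n<m. of_bool (P n) / \<beta> ^ n)"
      by (subst infsum_finite) (auto intro!: sum.mono_neutral_cong_left)
    ultimately show ?thesis by (simp only:)
  qed
  have tails: "{n. m \<le> n \<and> x < (T \<beta> \<alpha> ^^ n) 1} = {n. m \<le> n \<and> x < (T \<beta> \<alpha> ^^ n) 0}"
    using eq by auto
  show ?thesis
    unfolding g_tilde_def split[of "\<lambda>n. x < (T \<beta> \<alpha> ^^ n) 1"]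
      split[of "\<lambda>n. x < (T \<beta> \<alpha> ^^ n) 0"] tails
    by (simp add: sum_subtractf diff_divide_distrib)
qed

lemma g_tilde_eq_step:
  assumes \<beta>: "\<beta> > 1" and meet: "(1 - frac \<beta>) * (\<Sum>i<m. \<beta> ^ i) = 1"
    and \<alpha>: "0 \<le> \<alpha>" "\<alpha> < 1 - frac \<beta>"
  shows "g_tilde \<beta> \<alpha> x =
    (\<Sum>n<m. indicator {\<alpha> * (\<Sum>i<n. \<beta> ^ i)..<1 - (1 - frac \<beta> - \<alpha>) * (\<Sum>i<n. \<beta> ^ i)} x / \<beta> ^ n)"
proof -
  have "of_bool (x < (T \<beta> \<alpha> ^^ n) 1) - of_bool (x < (T \<beta> \<alpha> ^^ n) 0) =
      (indicator {\<alpha> * (\<Sum>i<n. \<beta> ^ i)..<1 - (1 - frac \<beta> - \<alpha>) * (\<Sum>i<n. \<beta> ^ i)} x :: real)"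
    if "n < m" for n
  proof -
    have "\<alpha> * (\<Sum>i<n. \<beta> ^ i) \<le> 1 - (1 - frac \<beta> - \<alpha>) * (\<Sum>i<n. \<beta> ^ i)"
      using geometric_sum_less_bound[OF \<beta> meet that] by (simp add: algebra_simps)
    then show ?thesis
      using orbit_0[OF \<beta> meet \<alpha>, of n] orbit_1[OF \<beta> meet \<alpha>, of n] that
      by (auto simp: indicator_def)
  qed
  then show ?thesis
    by (subst g_tilde_eq_finite_sum[OF \<beta> orbits_meet[OF \<beta> meet \<alpha>]])
      (auto intro!: sum.cong)
qed

section \<open>Mass and first moment\<close>

lemma has_bochner_integral_power_Ico:
  fixes a b :: real
  assumes "a \<le> b"
  shows "has_bochner_integral lborel (\<lambda>x. x ^ k * indicator {a..<b} x)
    ((b ^ Suc k - a ^ Suc k) / Suc k)"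
proof -
  have "AE x in lborel. x ^ k * indicator {a..<b} x = x ^ k * indicator {a..b} x"
    using AE_lborel_singleton[of b] by eventually_elim (auto simp: indicator_def)
  moreover have "has_bochner_integral lborel (\<lambda>x. x ^ k * indicator {a..b} x)
      (b ^ Suc k / Suc k - a ^ Suc k / Suc k)"
  proof (rule has_bochner_integral_FTC_Icc_real[OF assms])
    show "((\<lambda>x. x ^ Suc k / Suc k) has_real_derivative x ^ k) (at x)" for x :: real
      by (intro derivative_eq_intros) auto
  qed auto
  ultimately show ?thesis
    unfolding diff_divide_distrib
    by (subst has_bochner_integral_cong_AE) (auto intro: measurable_compose)
qed

lemma LINT_power_step_function:
  fixes a b w :: "nat \<Rightarrow> real"
  assumes ab: "\<And>n. n < m \<Longrightarrow> 0 \<le> a n \<and> a n \<le> b n \<and> b n \<le> 1"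
  shows "(LINT x:{0..1}|lborel. x ^ k * (\<Sum>n<m. indicator {a n..<b n} x / w n)) =
    (\<Sum>n<m. ((b n ^ Suc k - a n ^ Suc k) / Suc k) / w n)"
proof -
  have "has_bochner_integral lborel
      (\<lambda>x. \<Sum>n<m. (x ^ k * indicator {a n..<b n} x) / w n)
      (\<Sum>n<m. ((b n ^ Suc k - a n ^ Suc k) / Suc k) / w n)"
    using ab by (intro has_bochner_integral_sum has_bochner_integral_divide_zero
        has_bochner_integral_power_Ico) auto
  moreover have "indicator {0..1} x *\<^sub>R (x ^ k * (\<Sum>n<m. indicator {a n..<b n} x / w n)) =
      (\<Sum>n<m. (x ^ k * indicator {a n..<b n} x) / w n)" for x
  proof -
    have "indicator {0..1} x * indicator {a n..<b n} x = (indicator {a n..<b n} x :: real)"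
      if "n < m" for n
      using ab[OF that] by (auto simp: indicator_def)
    then have "indicator {0..1} x * (x ^ k * (indicator {a n..<b n} x / w n)) =
        x ^ k * indicator {a n..<b n} x / w n" if "n < m" for n
      using that by (metis (no_types, lifting) mult.left_commute times_divide_eq_right)
    then show ?thesis
      unfolding real_scaleR_def sum_distrib_left by (intro sum.cong) auto
  qed
  ultimately show ?thesis
    unfolding set_lebesgue_integral_def by (simp add: has_bochner_integral_integral_eq)
qed

text \<open>
  The mean of a mixture of uniform distributions is the weighted mean of the midpoints
  \<open>\<alpha> * s n + (1 - \<delta> * s n) / 2\<close> of the intervals, with weights \<open>(1 - \<delta> * s n) / \<beta> ^ n\<close> that are
  independent of \<open>\<alpha>\<close>.
\<close>

lemma M_eq_affine:
  assumes \<beta>: "\<beta> > 1" and meet: "(1 - frac \<beta>) * (\<Sum>i<m. \<beta> ^ i) = 1"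
    and \<alpha>: "0 \<le> \<alpha>" "\<alpha> < 1 - frac \<beta>"
  defines "s \<equiv> \<lambda>n. \<Sum>i<n. \<beta> ^ i"
  defines "d \<equiv> \<lambda>n. 1 - (1 - frac \<beta>) * s n"
  shows "M \<beta> \<alpha> = (\<Sum>n<m. d n * s n / \<beta> ^ n) / (\<Sum>n<m. d n / \<beta> ^ n) * \<alpha>
    + (\<Sum>n<m. (d n)\<^sup>2 / 2 / \<beta> ^ n) / (\<Sum>n<m. d n / \<beta> ^ n)"
proof -
  define b where "b = (\<lambda>n. 1 - (1 - frac \<beta> - \<alpha>) * s n)"
  have b_eq: "b n = \<alpha> * s n + d n" for n
    by (simp add: b_def d_def algebra_simps)
  have step: "g_tilde \<beta> \<alpha> x = (\<Sum>n<m. indicator {\<alpha> * s n..<b n} x / \<beta> ^ n)" for x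
    using g_tilde_eq_step[OF \<beta> meet \<alpha>] by (simp add: b_def s_def)
  have s_nonneg: "0 \<le> s n" for n
    using \<beta> by (auto simp: s_def intro!: sum_nonneg)
  have ends: "0 \<le> \<alpha> * s n \<and> \<alpha> * s n \<le> b n \<and> b n \<le> 1" if "n < m" for n
  proof -
    have "0 < d n"
      using geometric_sum_less_bound[OF \<beta> meet that] by (simp add: d_def s_def)
    moreover have "b n \<le> 1"
      using \<alpha> s_nonneg by (simp add: b_def)
    ultimately show ?thesis
      using \<alpha> s_nonneg by (simp add: b_eq)
  qed
  have mass: "(LINT x:{0..1}|lborel. g_tilde \<beta> \<alpha> x) = (\<Sum>n<m. d n / \<beta> ^ n)"
    using LINT_power_step_function[of m "\<lambda>n. \<alpha> * s n" b 0 "\<lambda>n. \<beta> ^ n", OF ends]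
    by (simp add: step b_eq)
  have "(LINT x:{0..1}|lborel. x * g_tilde \<beta> \<alpha> x) =
      (\<Sum>n<m. ((b n)\<^sup>2 - (\<alpha> * s n)\<^sup>2) / 2 / \<beta> ^ n)"
    using LINT_power_step_function[of m "\<lambda>n. \<alpha> * s n" b 1 "\<lambda>n. \<beta> ^ n", OF ends]
    by (simp add: step power2_eq_square)
  also have "\<dots> = (\<Sum>n<m. d n * s n / \<beta> ^ n * \<alpha> + (d n)\<^sup>2 / 2 / \<beta> ^ n)"
    by (intro sum.cong refl) (simp add: b_eq power2_eq_square algebra_simps add_divide_distrib)
  also have "\<dots> = (\<Sum>n<m. d n * s n / \<beta> ^ n) * \<alpha> + (\<Sum>n<m. (d n)\<^sup>2 / 2 / \<beta> ^ n)"
    by (simp add: sum.distrib sum_distrib_right)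
  finally have moment: "(LINT x:{0..1}|lborel. x * g_tilde \<beta> \<alpha> x) = \<dots>" .
  have "M \<beta> \<alpha> = (LINT x:{0..1}|lborel. x * g_tilde \<beta> \<alpha> x) / (\<Sum>n<m. d n / \<beta> ^ n)"
    unfolding M_def g_def mass by simp
  then show ?thesis
    by (simp add: moment add_divide_distrib)
qed

section \<open>The roots\<close>

text \<open>
  Divided by \<open>x ^ m\<close>, the right-hand side of the equation is a sum of strictly decreasing functions
  of \<open>x > 0\<close>; cross-multiplying two solutions avoids the division.
\<close>

lemma root_unique:
  fixes x y :: real
  assumes "0 < q" "0 < m" "0 < x" "0 < y"
    and x: "x ^ m = (\<Sum>i<m. real q * x ^ i)" and y: "y ^ m = (\<Sum>i<m. real q * y ^ i)"
  shows "x = y"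
proof -
  have False if "0 < u" "u < v"
    and u: "u ^ m = (\<Sum>i<m. real q * u ^ i)" and v: "v ^ m = (\<Sum>i<m. real q * v ^ i)"
    for u v :: real
  proof -
    have "(\<Sum>i<m. real q * v ^ i * u ^ m) < (\<Sum>i<m. real q * u ^ i * v ^ m)"
    proof (rule sum_strict_mono)
      fix i assume "i \<in> {..<m}"
      then obtain j where j: "m = i + j" "0 < j"
        by (metis lessThan_iff less_imp_add_positive)
      have "u ^ j < v ^ j"
        using that j by (intro power_strict_mono) auto
      then have "real q * u ^ i * v ^ i * u ^ j < real q * u ^ i * v ^ i * v ^ j"
        using that \<open>0 < q\<close> by (intro mult_strict_left_mono) auto
      then show "real q * v ^ i * u ^ m < real q * u ^ i * v ^ m"
        by (simp add: j power_add mult_ac)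
    qed (use \<open>0 < m\<close> in auto)
    then have "v ^ m * u ^ m < u ^ m * v ^ m"
      by (simp flip: sum_distrib_right u v)
    then show False by simp
  qed
  then show ?thesis
    using assms by (metis linorder_neqE_linordered_idom)
qed

lemma root_exists:
  assumes "1 \<le> q" "2 \<le> m"
  shows "\<exists>x. real q < x \<and> x < real q + 1 \<and> x ^ m = (\<Sum>i<m. real q * x ^ i)"
proof -
  define f where "f = (\<lambda>x::real. x ^ m - (\<Sum>i<m. real q * x ^ i))"
  obtain k where k: "m = Suc (Suc k)"
    using assms(2) by (metis add_2_eq_Suc le_Suc_ex)
  have "(\<Sum>i<m. real q * real q ^ i) =
      real q + (\<Sum>i<k. real q * real q ^ Suc i) + real q ^ m"
    unfolding k by (subst sum.lessThan_Suc) (simp add: sum.lessThan_Suc_shift del: sum.lessThan_Suc)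
  moreover have "0 \<le> (\<Sum>i<k. real q * real q ^ Suc i)"
    by (intro sum_nonneg) auto
  ultimately have neg: "f (real q) < 0"
    using assms(1) by (simp add: f_def)
  have "(\<Sum>i<m. real q * (real q + 1) ^ i) = (real q + 1) ^ m - 1"
    using power_diff_1_eq[of "real q + 1" m] by (simp add: sum_distrib_left)
  then have pos: "f (real q + 1) = 1"
    by (simp add: f_def)
  have "\<exists>x. real q \<le> x \<and> x \<le> real q + 1 \<and> f x = 0"
    using neg pos by (intro IVT) (auto simp: f_def)
  then show ?thesis
    using neg pos unfolding f_def
    by (metis eq_iff_diff_eq_0 less_irrefl order_le_less zero_neq_one)
qed

lemma beta_root_props:
  assumes "1 \<le> q" "1 \<le> m"
  shows "real q \<le> beta_root q m" "beta_root q m < real q + 1"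
    and "beta_root q m ^ m = (\<Sum>i<m. real q * beta_root q m ^ i)"
    and "2 \<le> m \<Longrightarrow> real q < beta_root q m"
proof -
  let ?P = "\<lambda>x. real q < x \<and> x < real q + 1 \<and> x ^ m = (\<Sum>i<m. real q * x ^ i)"
  have "?P (beta_root q m)" if "2 \<le> m"
  proof -
    have "\<exists>!x. ?P x"
    proof (rule ex_ex1I)
      show "\<exists>x. ?P x"
        using root_exists[OF assms(1) that] .
      show "x = y" if "?P x" "?P y" for x y
      proof (rule root_unique[of q m])
        show "0 < x" "0 < y"
          using that by linarith+
      qed (use that assms in linarith)+
    qed
    from theI'[OF this] show ?thesis
      using that by (simp add: beta_root_def)
  qed
  moreover have "beta_root q m = real q" if "m = 1"
    using that by (simp add: beta_root_def)
  moreover have "m = 1 \<or> 2 \<le> m"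
    using assms by auto
  ultimately show "real q \<le> beta_root q m" "beta_root q m < real q + 1"
    and "beta_root q m ^ m = (\<Sum>i<m. real q * beta_root q m ^ i)"
    and "2 \<le> m \<Longrightarrow> real q < beta_root q m"
    by auto
qed

text \<open>
  Multiplying the equation \<open>\<beta> ^ m = q * s m\<close> by \<open>\<beta> - 1\<close> telescopes it to \<open>(q + 1 - \<beta>) * \<beta> ^ m = q\<close>, and
  \<open>q + 1 - \<beta>\<close> is \<open>1 - frac \<beta>\<close>.
\<close>

lemma beta_root_meet:
  assumes "1 \<le> q" "1 \<le> m"
  shows "(1 - frac (beta_root q m)) * (\<Sum>i<m. beta_root q m ^ i) = 1"
proof -
  define \<beta> where "\<beta> = beta_root q m"
  define S where "S = (\<Sum>i<m. \<beta> ^ i)"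
  note props = beta_root_props[OF assms, folded \<beta>_def]
  have "\<lfloor>\<beta>\<rfloor> = int q"
    using props(1,2) by (intro floor_unique) auto
  then have frac: "1 - frac \<beta> = real q + 1 - \<beta>"
    by (simp add: frac_def)
  have root: "\<beta> ^ m = real q * S"
    using props(3) by (simp add: S_def sum_distrib_left)
  have "\<beta> ^ m - 1 = (\<beta> - 1) * S"
    using power_diff_1_eq[of \<beta> m] by (simp add: S_def)
  then have "(real q + 1 - \<beta>) * S = 1"
    by (simp add: root algebra_simps)
  then show ?thesis
    unfolding \<beta>_def[symmetric] S_def[symmetric] frac .
qed

theorem theorem3p1:
  fixes q m :: nat
  assumes "q \<ge> 1" and "m \<ge> 1" and "beta_root q m > 1"
  shows "(\<exists>k b :: real. \<forall>\<alpha> \<in> {0..<1 - frac (beta_root q m)}.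
            M (beta_root q m) \<alpha> = k * \<alpha> + b) \<and>
         mono_on {0..<1 - frac (beta_root q m)} (M (beta_root q m)) \<and>
         (m \<ge> 2 \<longrightarrow> strict_mono_on {0..<1 - frac (beta_root q m)} (M (beta_root q m)))"
proof -
  define \<beta> where "\<beta> = beta_root q m"
  define s where "s = (\<lambda>n. \<Sum>i<n. \<beta> ^ i)"
  define d where "d = (\<lambda>n. 1 - (1 - frac \<beta>) * s n)"
  define k where "k = (\<Sum>n<m. d n * s n / \<beta> ^ n) / (\<Sum>n<m. d n / \<beta> ^ n)"
  define b where "b = (\<Sum>n<m. (d n)\<^sup>2 / 2 / \<beta> ^ n) / (\<Sum>n<m. d n / \<beta> ^ n)"
  have \<beta>: "\<beta> > 1"
    using assms(3) by (simp add: \<beta>_def)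
  have meet: "(1 - frac \<beta>) * (\<Sum>i<m. \<beta> ^ i) = 1"
    using beta_root_meet[OF assms(1,2)] by (simp add: \<beta>_def)
  have affine: "M \<beta> \<alpha> = k * \<alpha> + b" if "\<alpha> \<in> {0..<1 - frac \<beta>}" for \<alpha>
    using M_eq_affine[OF \<beta> meet, of \<alpha>] that by (simp add: k_def b_def d_def s_def)
  have d_pos: "0 < d n" if "n < m" for n
    using geometric_sum_less_bound[OF \<beta> meet that] by (simp add: d_def s_def)
  have s_nonneg: "0 \<le> s n" for n
    using \<beta> by (auto simp: s_def intro!: sum_nonneg)
  have mass_pos: "0 < (\<Sum>n<m. d n / \<beta> ^ n)"
    using assms(2) d_pos \<beta> by (intro sum_pos) (auto simp: lessThan_empty_iff)
  have term_nonneg: "0 \<le> d n * s n / \<beta> ^ n" if "n < m" for n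
    using d_pos[OF that] s_nonneg \<beta> by simp
  have k_nonneg: "0 \<le> k"
    unfolding k_def
    by (rule divide_nonneg_pos[OF sum_nonneg mass_pos]) (rule term_nonneg, simp)
  have k_pos: "0 < k" if "2 \<le> m"
  proof -
    \<comment> \<open>The interval of index \<open>0\<close> is the whole unit interval and stays fixed; index \<open>1\<close> moves.\<close>
    have "0 < d 1 * s 1 / \<beta> ^ 1"
      using d_pos[of 1] that \<beta> by (simp add: s_def)
    then have "0 < (\<Sum>n<m. d n * s n / \<beta> ^ n)"
      using that term_nonneg by (intro sum_pos2[of _ 1]) auto
    then show ?thesis
      using mass_pos by (simp add: k_def)
  qed
  have "mono_on {0..<1 - frac \<beta>} (M \<beta>)"
    using k_nonneg by (intro mono_onI) (auto simp: affine mult_left_mono)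
  moreover have "strict_mono_on {0..<1 - frac \<beta>} (M \<beta>)" if "2 \<le> m"
    using k_pos[OF that] by (intro strict_mono_onI) (auto simp: affine)
  ultimately show ?thesis
    using affine unfolding \<beta>_def by blast
qed

end
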